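(* Let $X$ be a finitely supported random vector in $\mathbb R^d$ with mean $\mu=\mathbb E X$, let $M$ be a symmetric positive definite $d\times d$ matrix, and let $u\in\mathbb R^d$, $u\ne0$. With the notation of the context, let $z(Y):=z_i$ on $\{Y=t_i\}$ and $$\sigma^2_{\mathrm{fib}}:=\mathbb E\|X-\mu-z(Y)\|_M^2 .$$ Then, for $1\le i\le m-1$, $$V_i=\sigma^2_{\mathrm{fib}}+\sum_{j\le i}p_j\|z_j-a_i\|_M^2+\sum_{j>i}p_j\|z_j-b_i\|_M^2 ,$$ and at the endpoints $$V_0=V_m=T=\sigma^2_{\mathrm{fib}}+\sum_{j=1}^m p_j\|z_j\|_M^2 .$$ Thus the dispersion inside the fibers contributes the same constant to every cut. Moreover, for $1\le i\le m-1$, putting $$S_i:=\mathbb E\bigl[(X-\mu)\mathbf 1_{\{Y\le t_i\}}\bigr]=P_ia_i=-q_ib_i ,$$ one has $$V_i=T-B_i,\qquad B_i=P_iq_i\|a_i-b_i\|_M^2=\frac{\|S_i\|_M^2}{P_iq_i},$$ with $B_0=B_m=0$ (where $B_i:=T-V_i$).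
   Context: Write $\langle x,y\rangle_M:=x^{\mathsf T}My$ and $\|x\|_M^2:=\langle x,x\rangle_M$. Order the distinct values of $Y:=u^{\mathsf T}(X-\mu)$ as $t_1<\cdots<t_m$. Put $p_i:=\mathbb P(Y=t_i)$, $z_i:=\mathbb E[X-\mu\mid Y=t_i]$ (the barycenter of the $i$th fiber), $P_i:=\sum_{j\le i}p_j$, $q_i:=1-P_i$, and $$a_i:=\frac1{P_i}\sum_{j\le i}p_jz_j\ (1\le i\le m),\qquad b_i:=\frac1{q_i}\sum_{j>i}p_jz_j\ (0\le i\le m-1).$$ For $1\le i\le m-1$, $V_i$ is the least quadratic risk obtained from the partition $\{Y\le t_i\}\mid\{Y>t_i\}$, i.e. the minimum over $\alpha,\beta\in\mathbb R^d$ of $\mathbb E[\|X-\alpha\|_M^2\mathbf 1_{\{Y\le t_i\}}+\|X-\beta\|_M^2\mathbf 1_{\{Y>t_i\}}]$. Also $V_0=V_m:=T$ with $T:=\mathbb E\|X-\mu\|_M^2$. *)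

theory Defs
  imports "HOL-Probability.Probability"
begin

definition mat_inner :: "real^'d^'d \<Rightarrow> real^'d \<Rightarrow> real^'d \<Rightarrow> real" where
  "mat_inner M x y = x \<bullet> (M *v y)"

definition mat_sqnorm :: "real^'d^'d \<Rightarrow> real^'d \<Rightarrow> real" where
  "mat_sqnorm M x = mat_inner M x x"

definition centred :: "'w measure \<Rightarrow> ('w \<Rightarrow> real^'d) \<Rightarrow> 'w \<Rightarrow> real^'d" where
  "centred \<Omega> X \<omega> = X \<omega> - (LINT \<omega>'|\<Omega>. X \<omega>')"

definition proj :: "'w measure \<Rightarrow> ('w \<Rightarrow> real^'d) \<Rightarrow> real^'d \<Rightarrow> 'w \<Rightarrow> real" where
  "proj \<Omega> X u \<omega> = u \<bullet> centred \<Omega> X \<omega>"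

text \<open>The values of \<open>Y = proj \<Omega> X u\<close> are those taken with positive probability, so that
  conditioning on a fiber makes sense even if \<open>Y\<close> takes further values on a null set.\<close>

definition proj_values :: "'w measure \<Rightarrow> ('w \<Rightarrow> real^'d) \<Rightarrow> real^'d \<Rightarrow> real set" where
  "proj_values \<Omega> X u = {s. measure \<Omega> {\<omega> \<in> space \<Omega>. proj \<Omega> X u \<omega> = s} > 0}"

definition num_fibers :: "'w measure \<Rightarrow> ('w \<Rightarrow> real^'d) \<Rightarrow> real^'d \<Rightarrow> nat" where
  "num_fibers \<Omega> X u = card (proj_values \<Omega> X u)"

text \<open>Indices run from \<open>1\<close> to \<open>m = num_fibers \<Omega> X u\<close>; at other indices the value is irrelevant.\<close>

definition fiber_value :: "'w measure \<Rightarrow> ('w \<Rightarrow> real^'d) \<Rightarrow> real^'d \<Rightarrow> nat \<Rightarrow> real" where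
  "fiber_value \<Omega> X u i = sorted_list_of_set (proj_values \<Omega> X u) ! (i - 1)"

definition fiber :: "'w measure \<Rightarrow> ('w \<Rightarrow> real^'d) \<Rightarrow> real^'d \<Rightarrow> nat \<Rightarrow> 'w set" where
  "fiber \<Omega> X u i = {\<omega> \<in> space \<Omega>. proj \<Omega> X u \<omega> = fiber_value \<Omega> X u i}"

definition fiber_prob :: "'w measure \<Rightarrow> ('w \<Rightarrow> real^'d) \<Rightarrow> real^'d \<Rightarrow> nat \<Rightarrow> real" where
  "fiber_prob \<Omega> X u i = measure \<Omega> (fiber \<Omega> X u i)"

text \<open>The elementary conditional expectation given an event of positive probability.\<close>

definition cond_mean :: "'w measure \<Rightarrow> ('w \<Rightarrow> real^'d) \<Rightarrow> 'w set \<Rightarrow> real^'d" where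
  "cond_mean \<Omega> Z A = (1 / measure \<Omega> A) *\<^sub>R (LINT \<omega>:A|\<Omega>. Z \<omega>)"

definition barycenter :: "'w measure \<Rightarrow> ('w \<Rightarrow> real^'d) \<Rightarrow> real^'d \<Rightarrow> nat \<Rightarrow> real^'d" where
  "barycenter \<Omega> X u i = cond_mean \<Omega> (centred \<Omega> X) (fiber \<Omega> X u i)"

definition barycenter_rv :: "'w measure \<Rightarrow> ('w \<Rightarrow> real^'d) \<Rightarrow> real^'d \<Rightarrow> 'w \<Rightarrow> real^'d" where
  "barycenter_rv \<Omega> X u \<omega> =
     (\<Sum>i = 1..num_fibers \<Omega> X u. indicator (fiber \<Omega> X u i) \<omega> *\<^sub>R barycenter \<Omega> X u i)"

definition left_prob :: "'w measure \<Rightarrow> ('w \<Rightarrow> real^'d) \<Rightarrow> real^'d \<Rightarrow> nat \<Rightarrow> real" where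
  "left_prob \<Omega> X u i = (\<Sum>j = 1..i. fiber_prob \<Omega> X u j)"

definition right_prob :: "'w measure \<Rightarrow> ('w \<Rightarrow> real^'d) \<Rightarrow> real^'d \<Rightarrow> nat \<Rightarrow> real" where
  "right_prob \<Omega> X u i = 1 - left_prob \<Omega> X u i"

definition left_mean :: "'w measure \<Rightarrow> ('w \<Rightarrow> real^'d) \<Rightarrow> real^'d \<Rightarrow> nat \<Rightarrow> real^'d" where
  "left_mean \<Omega> X u i =
     (1 / left_prob \<Omega> X u i) *\<^sub>R (\<Sum>j = 1..i. fiber_prob \<Omega> X u j *\<^sub>R barycenter \<Omega> X u j)"

definition right_mean :: "'w measure \<Rightarrow> ('w \<Rightarrow> real^'d) \<Rightarrow> real^'d \<Rightarrow> nat \<Rightarrow> real^'d" where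
  "right_mean \<Omega> X u i =
     (1 / right_prob \<Omega> X u i) *\<^sub>R
       (\<Sum>j = i+1..num_fibers \<Omega> X u. fiber_prob \<Omega> X u j *\<^sub>R barycenter \<Omega> X u j)"

definition left_event :: "'w measure \<Rightarrow> ('w \<Rightarrow> real^'d) \<Rightarrow> real^'d \<Rightarrow> nat \<Rightarrow> 'w set" where
  "left_event \<Omega> X u i = {\<omega> \<in> space \<Omega>. proj \<Omega> X u \<omega> \<le> fiber_value \<Omega> X u i}"

definition right_event :: "'w measure \<Rightarrow> ('w \<Rightarrow> real^'d) \<Rightarrow> real^'d \<Rightarrow> nat \<Rightarrow> 'w set" where
  "right_event \<Omega> X u i = {\<omega> \<in> space \<Omega>. proj \<Omega> X u \<omega> > fiber_value \<Omega> X u i}"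

definition left_moment :: "'w measure \<Rightarrow> ('w \<Rightarrow> real^'d) \<Rightarrow> real^'d \<Rightarrow> nat \<Rightarrow> real^'d" where
  "left_moment \<Omega> X u i = (LINT \<omega>:left_event \<Omega> X u i|\<Omega>. centred \<Omega> X \<omega>)"

definition total_var :: "'w measure \<Rightarrow> ('w \<Rightarrow> real^'d) \<Rightarrow> real^'d^'d \<Rightarrow> real" where
  "total_var \<Omega> X M = (LINT \<omega>|\<Omega>. mat_sqnorm M (centred \<Omega> X \<omega>))"

definition fib_var :: "'w measure \<Rightarrow> ('w \<Rightarrow> real^'d) \<Rightarrow> real^'d^'d \<Rightarrow> real^'d \<Rightarrow> real" where
  "fib_var \<Omega> X M u = (LINT \<omega>|\<Omega>. mat_sqnorm M (centred \<Omega> X \<omega> - barycenter_rv \<Omega> X u \<omega>))"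

definition cut_risk ::
  "'w measure \<Rightarrow> ('w \<Rightarrow> real^'d) \<Rightarrow> real^'d^'d \<Rightarrow> real^'d \<Rightarrow> nat \<Rightarrow> real^'d \<Rightarrow> real^'d \<Rightarrow> real" where
  "cut_risk \<Omega> X M u i \<alpha> \<beta> =
     (LINT \<omega>|\<Omega>. mat_sqnorm M (X \<omega> - \<alpha>) * indicator (left_event \<Omega> X u i) \<omega> +
                 mat_sqnorm M (X \<omega> - \<beta>) * indicator (right_event \<Omega> X u i) \<omega>)"

text \<open>\<open>LEAST\<close> is the attained minimum (and not an infimum); the two endpoint values are a
  convention.\<close>

definition cut_value ::
  "'w measure \<Rightarrow> ('w \<Rightarrow> real^'d) \<Rightarrow> real^'d^'d \<Rightarrow> real^'d \<Rightarrow> nat \<Rightarrow> real" where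
  "cut_value \<Omega> X M u i =
     (if i = 0 \<or> i = num_fibers \<Omega> X u then total_var \<Omega> X M
      else (LEAST v. \<exists>\<alpha> \<beta>. v = cut_risk \<Omega> X M u i \<alpha> \<beta>))"

definition cut_gain ::
  "'w measure \<Rightarrow> ('w \<Rightarrow> real^'d) \<Rightarrow> real^'d^'d \<Rightarrow> real^'d \<Rightarrow> nat \<Rightarrow> real" where
  "cut_gain \<Omega> X M u i = total_var \<Omega> X M - cut_value \<Omega> X M u i"

end

theory Submission
  imports Defs
begin

text \<open>
  Expanding the square on an event \<open>A\<close> of probability \<open>p\<close> shows that the risk of the constant
  \<open>c\<close> on \<open>A\<close> exceeds \<open>Q - \<parallel>S\<parallel>\<^sup>2 / p\<close> by \<open>p \<parallel>c - S / p\<parallel>\<^sup>2\<close>, where \<open>Q\<close> and \<open>S\<close> are the second and first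
  moments on \<open>A\<close>. Applied to the two sides of a cut, whose first moments cancel, this gives
  \<open>V\<^sub>i = T - \<parallel>S\<^sub>i\<parallel>\<^sup>2 / (P\<^sub>i q\<^sub>i)\<close>; applied to the fibers it gives \<open>T = \<sigma>\<^sup>2 + \<Sum>\<^sub>j p\<^sub>j \<parallel>z\<^sub>j\<parallel>\<^sup>2\<close>. The
  same expansion for the finitely many weighted points \<open>z\<^sub>j\<close> yields the remaining formula.
\<close>

section \<open>The bilinear form of \<open>M\<close> and completion of the square\<close>

lemma bounded_linear_mat_inner: "bounded_linear (mat_inner M c)"
  unfolding mat_inner_def
  using bounded_linear_compose[OF bounded_linear_inner_right matrix_vector_mul_bounded_linear[of M]]
  by simp

lemma continuous_on_mat_inner [continuous_intros]:
  assumes "continuous_on A f" "continuous_on A g"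
  shows "continuous_on A (\<lambda>x. mat_inner M (f x) (g x))"
  unfolding mat_inner_def
  by (intro continuous_intros assms
      bounded_linear.continuous_on[OF matrix_vector_mul_bounded_linear])

lemma mat_inner_commute:
  assumes "transpose M = M"
  shows "mat_inner M x y = mat_inner M y x"
  unfolding mat_inner_def
  by (metis assms dot_lmul_matrix inner_commute transpose_matrix_vector)

lemma mat_inner_scaleR_right: "mat_inner M x (r *\<^sub>R y) = r * mat_inner M x y"
  by (simp add: mat_inner_def matrix_vector_mult_scaleR)

lemma mat_sqnorm_scaleR: "mat_sqnorm M (r *\<^sub>R x) = r\<^sup>2 * mat_sqnorm M x"
  by (simp add: mat_sqnorm_def mat_inner_def matrix_vector_mult_scaleR power2_eq_square)

lemma mat_sqnorm_minus: "mat_sqnorm M (- x) = mat_sqnorm M x"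
  using mat_sqnorm_scaleR[of M "-1" x] by simp

lemma mat_sqnorm_diff:
  assumes "transpose M = M"
  shows "mat_sqnorm M (x - y) = mat_sqnorm M x - 2 * mat_inner M y x + mat_sqnorm M y"
  using mat_inner_commute[OF assms, of x y]
  by (simp add: mat_sqnorm_def mat_inner_def matrix_vector_mult_diff_distrib inner_diff_left
      inner_diff_right)

text \<open>Symmetry of \<open>M\<close> merges the two cross terms. The left-hand side has the
  shape in which the risk of a constant \<open>c\<close> appears after expansion, for integrals as
  well as for finite sums; \<open>Q\<close> is only carried along so that both cases match.\<close>

lemma mat_sqnorm_complete_square:
  assumes "transpose M = M" and "p \<noteq> 0"
  shows "Q - 2 * mat_inner M c S + p * mat_sqnorm M c
    = Q - mat_sqnorm M S / p + p * mat_sqnorm M (c - (1 / p) *\<^sub>R S)"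
proof -
  have "mat_sqnorm M (c - (1 / p) *\<^sub>R S)
      = mat_sqnorm M c - 2 / p * mat_inner M c S + mat_sqnorm M S / p\<^sup>2"
    using mat_inner_commute[OF assms(1), of "(1 / p) *\<^sub>R S" c]
    by (simp add: mat_sqnorm_diff[OF assms(1)] mat_inner_scaleR_right mat_sqnorm_scaleR
        power_divide)
  then show ?thesis
    using assms(2) by (simp add: field_simps power2_eq_square)
qed

text \<open>Expanding each square gives the pattern of \<open>mat_sqnorm_complete_square\<close>,
  and at the weighted mean the completed square vanishes.\<close>

lemma sum_mat_sqnorm_diff_mean:
  assumes "transpose M = M" and "(\<Sum>j\<in>J. p j) \<noteq> 0"
  shows "(\<Sum>j\<in>J. p j * mat_sqnorm M (z j - (1 / (\<Sum>j\<in>J. p j)) *\<^sub>R (\<Sum>j\<in>J. p j *\<^sub>R z j)))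
    = (\<Sum>j\<in>J. p j * mat_sqnorm M (z j)) - mat_sqnorm M (\<Sum>j\<in>J. p j *\<^sub>R z j) / (\<Sum>j\<in>J. p j)"
proof -
  let ?P = "\<Sum>j\<in>J. p j" and ?S = "\<Sum>j\<in>J. p j *\<^sub>R z j"
  define c where "c = (1 / ?P) *\<^sub>R ?S"
  have inner_S: "mat_inner M c ?S = (\<Sum>j\<in>J. p j * mat_inner M c (z j))"
    by (simp add: linear_sum[OF bounded_linear.linear[OF bounded_linear_mat_inner]]
        mat_inner_scaleR_right)
  have "(\<Sum>j\<in>J. p j * mat_sqnorm M (z j - c))
      = (\<Sum>j\<in>J. p j * mat_sqnorm M (z j) - 2 * (p j * mat_inner M c (z j)) + p j * mat_sqnorm M c)"
    by (simp add: mat_sqnorm_diff[OF assms(1)] algebra_simps)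
  also have "\<dots> = (\<Sum>j\<in>J. p j * mat_sqnorm M (z j)) - 2 * mat_inner M c ?S + ?P * mat_sqnorm M c"
    by (simp add: inner_S sum.distrib sum_subtractf sum_distrib_left sum_distrib_right)
  also have "\<dots> = (\<Sum>j\<in>J. p j * mat_sqnorm M (z j)) - mat_sqnorm M ?S / ?P"
    unfolding mat_sqnorm_complete_square[OF assms]
    by (simp add: c_def mat_sqnorm_def mat_inner_def)
  finally show ?thesis
    by (simp add: c_def)
qed

section \<open>Standing assumptions, measurability and integrability\<close>

locale finite_random_vector = prob_space \<Omega> for \<Omega> :: "'w measure" +
  fixes X :: "'w \<Rightarrow> real^'d" and M :: "real^'d^'d" and u :: "real^'d" and F :: "(real^'d) set"
  assumes measurable_X [measurable]: "X \<in> borel_measurable \<Omega>"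
    and finite_F: "finite F"
    and AE_X_in_F: "AE \<omega> in \<Omega>. X \<omega> \<in> F"
    and symmetric_M: "transpose M = M"
    and pos_def_M: "\<forall>x. x \<noteq> 0 \<longrightarrow> x \<bullet> (M *v x) > 0"
begin

abbreviation "m \<equiv> num_fibers \<Omega> X u"
abbreviation "Y \<equiv> proj \<Omega> X u"
abbreviation "W \<equiv> centred \<Omega> X"
abbreviation "t \<equiv> fiber_value \<Omega> X u"
abbreviation "p \<equiv> fiber_prob \<Omega> X u"
abbreviation "z \<equiv> barycenter \<Omega> X u"

text \<open>Positive definiteness enters here: it makes the squares completed in
  \<open>cut_risk_eq\<close> nonnegative, so that the risk of a cut is bounded below by its value at
  the two means.\<close>

lemma mat_sqnorm_nonneg: "mat_sqnorm M x \<ge> 0"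
  using pos_def_M by (cases "x = 0") (auto simp: mat_sqnorm_def mat_inner_def less_imp_le)

lemma measurable_W [measurable]: "W \<in> borel_measurable \<Omega>"
  unfolding centred_def by measurable

lemma measurable_Y [measurable]: "Y \<in> borel_measurable \<Omega>"
  unfolding proj_def by measurable

lemma measurable_fiber [measurable]: "fiber \<Omega> X u i \<in> events"
  unfolding fiber_def by measurable

lemma measurable_left_event [measurable]: "left_event \<Omega> X u i \<in> events"
  unfolding left_event_def by measurable

lemma measurable_right_event [measurable]: "right_event \<Omega> X u i \<in> events"
  unfolding right_event_def by measurable

text \<open>Almost surely \<open>X\<close> takes one of finitely many values, so
  \<open>g (X \<omega>)\<close> is essentially bounded. The sum of the norms over \<open>F\<close>
  is a crude bound, but unlike a maximum it needs no nonempty \<open>F\<close>.\<close>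

lemma integrable_compose_X:
  fixes g :: "real^'d \<Rightarrow> 'b :: {banach, second_countable_topology}"
  assumes "continuous_on UNIV g"
  shows "integrable \<Omega> (\<lambda>\<omega>. g (X \<omega>))"
proof (rule integrable_const_bound)
  show "AE \<omega> in \<Omega>. norm (g (X \<omega>)) \<le> (\<Sum>x\<in>F. norm (g x))"
    using AE_X_in_F
  proof eventually_elim
    case (elim \<omega>)
    then show ?case
      using member_le_sum[OF elim, of "\<lambda>x. norm (g x)"] finite_F by simp
  qed
  show "(\<lambda>\<omega>. g (X \<omega>)) \<in> borel_measurable \<Omega>"
    using borel_measurable_continuous_onI[OF assms] by measurable
qed

lemma integrable_W: "integrable \<Omega> W"
  unfolding centred_def by (intro integrable_compose_X continuous_intros)

lemma integrable_mat_sqnorm: "integrable \<Omega> (\<lambda>\<omega>. mat_sqnorm M (W \<omega> - c))"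
  unfolding centred_def mat_sqnorm_def by (intro integrable_compose_X continuous_intros)

lemma expectation_W: "(LINT \<omega>|\<Omega>. W \<omega>) = 0"
  using integrable_compose_X[of "\<lambda>x. x"]
  by (simp add: centred_def prob_space)

lemma set_integral_mat_sqnorm:
  assumes [measurable]: "A \<in> events"
  shows "(LINT \<omega>:A|\<Omega>. mat_sqnorm M (W \<omega> - c))
    = (LINT \<omega>:A|\<Omega>. mat_sqnorm M (W \<omega>)) - 2 * mat_inner M c (LINT \<omega>:A|\<Omega>. W \<omega>)
      + prob A * mat_sqnorm M c"
proof -
  have int_sq: "integrable \<Omega> (\<lambda>\<omega>. indicator A \<omega> * mat_sqnorm M (W \<omega>))"
    using integrable_mult_indicator[OF assms integrable_mat_sqnorm[of 0]] by simp
  have int_W: "integrable \<Omega> (\<lambda>\<omega>. indicator A \<omega> *\<^sub>R W \<omega>)"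
    by (rule integrable_mult_indicator[OF assms integrable_W])
  \<comment> \<open>With the indicator inside the second argument, the cross term is a bounded
    linear image of an integrable vector, so the form can be exchanged with the integral.\<close>
  have int_inner: "integrable \<Omega> (\<lambda>\<omega>. mat_inner M c (indicator A \<omega> *\<^sub>R W \<omega>))"
    by (rule integrable_bounded_linear[OF bounded_linear_mat_inner int_W])
  have int_const: "integrable \<Omega> (\<lambda>\<omega>. indicator A \<omega> * mat_sqnorm M c)"
    using integrable_mult_indicator[OF assms integrable_const[of "mat_sqnorm M c"]] by simp
  have "(LINT \<omega>:A|\<Omega>. mat_sqnorm M (W \<omega> - c))
      = (LINT \<omega>|\<Omega>. indicator A \<omega> * mat_sqnorm M (W \<omega>)
          - 2 * mat_inner M c (indicator A \<omega> *\<^sub>R W \<omega>) + indicator A \<omega> * mat_sqnorm M c)"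
    unfolding set_lebesgue_integral_def
    by (simp add: mat_sqnorm_diff[OF symmetric_M] mat_inner_scaleR_right algebra_simps)
  also have "\<dots> = (LINT \<omega>|\<Omega>. indicator A \<omega> * mat_sqnorm M (W \<omega>))
      - 2 * (LINT \<omega>|\<Omega>. mat_inner M c (indicator A \<omega> *\<^sub>R W \<omega>))
      + (LINT \<omega>|\<Omega>. indicator A \<omega> * mat_sqnorm M c)"
    using int_sq int_inner int_const by simp
  also have "(LINT \<omega>|\<Omega>. mat_inner M c (indicator A \<omega> *\<^sub>R W \<omega>))
      = mat_inner M c (LINT \<omega>|\<Omega>. indicator A \<omega> *\<^sub>R W \<omega>)"
    by (rule integral_bounded_linear[OF bounded_linear_mat_inner int_W])
  finally show ?thesis
    by (simp add: set_lebesgue_integral_def)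
qed

section \<open>The values of \<open>Y\<close> and their enumeration\<close>

lemma AE_Y_in_image: "AE \<omega> in \<Omega>. Y \<omega> \<in> (\<lambda>x. u \<bullet> (x - expectation X)) ` F"
  using AE_X_in_F by eventually_elim (auto simp: proj_def centred_def)

text \<open>A value outside the affine image of \<open>F\<close> is almost surely missed, so it has
  probability zero and is not counted.\<close>

lemma finite_proj_values: "finite (proj_values \<Omega> X u)"
proof (rule finite_subset)
  show "proj_values \<Omega> X u \<subseteq> (\<lambda>x. u \<bullet> (x - expectation X)) ` F"
  proof
    fix s
    assume s: "s \<in> proj_values \<Omega> X u"
    show "s \<in> (\<lambda>x. u \<bullet> (x - expectation X)) ` F"
    proof (rule ccontr)
      assume s_notin: "s \<notin> (\<lambda>x. u \<bullet> (x - expectation X)) ` F"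
      have "AE \<omega> in \<Omega>. Y \<omega> \<noteq> s"
        using AE_Y_in_image by eventually_elim (use s_notin in auto)
      then have "prob {\<omega> \<in> space \<Omega>. Y \<omega> = s} = 0"
        by (subst prob_Collect_eq_0) auto
      with s show False
        by (simp add: proj_values_def)
    qed
  qed
qed (use finite_F in simp)

text \<open>Each discarded value is avoided almost surely. Finiteness of the image of
  \<open>F\<close> leaves finitely many exceptional null sets to combine.\<close>

lemma AE_Y_in_proj_values: "AE \<omega> in \<Omega>. Y \<omega> \<in> proj_values \<Omega> X u"
proof -
  have "AE \<omega> in \<Omega>. Y \<omega> \<noteq> s" if "s \<notin> proj_values \<Omega> X u" for s
    using that measure_nonneg[of \<Omega> "{\<omega> \<in> space \<Omega>. Y \<omega> = s}"]
    by (subst prob_Collect_eq_0[symmetric]) (auto simp: proj_values_def)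
  then have "AE \<omega> in \<Omega>. \<forall>s \<in> (\<lambda>x. u \<bullet> (x - expectation X)) ` F - proj_values \<Omega> X u. Y \<omega> \<noteq> s"
    using finite_F by (intro AE_finite_allI) auto
  with AE_Y_in_image show ?thesis
    by eventually_elim auto
qed

lemma fiber_value_in_proj_values: "1 \<le> i \<Longrightarrow> i \<le> m \<Longrightarrow> t i \<in> proj_values \<Omega> X u"
  unfolding fiber_value_def num_fibers_def
  using finite_proj_values nth_mem[of "i - 1" "sorted_list_of_set (proj_values \<Omega> X u)"] by simp

text \<open>The list is read at position \<open>i - 1\<close> with truncated subtraction, so indices
  0 and 1 would give the same value; hence \<open>1 \<le> i\<close>.\<close>

lemma fiber_value_less: "1 \<le> i \<Longrightarrow> i < j \<Longrightarrow> j \<le> m \<Longrightarrow> t i < t j"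
  unfolding fiber_value_def num_fibers_def
  using sorted_wrt_nth_less[OF strict_sorted_list_of_set, of "i - 1" "j - 1" "proj_values \<Omega> X u"]
  by simp

lemma fiber_value_le_iff: "i \<in> {1..m} \<Longrightarrow> j \<in> {1..m} \<Longrightarrow> t i \<le> t j \<longleftrightarrow> i \<le> j"
  using fiber_value_less[of i j] fiber_value_less[of j i]
  by (cases i j rule: linorder_cases) auto

lemma fiber_value_eq_iff: "i \<in> {1..m} \<Longrightarrow> j \<in> {1..m} \<Longrightarrow> t i = t j \<longleftrightarrow> i = j"
  using fiber_value_le_iff[of i j] fiber_value_le_iff[of j i] by auto

lemma AE_in_fiber: "AE \<omega> in \<Omega>. \<exists>k \<in> {1..m}. Y \<omega> = t k"
  using AE_Y_in_proj_values
proof eventually_elim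
  case (elim \<omega>)
  then obtain n where "n < m" "sorted_list_of_set (proj_values \<Omega> X u) ! n = Y \<omega>"
    using finite_proj_values
    by (metis in_set_conv_nth num_fibers_def length_sorted_list_of_set set_sorted_list_of_set)
  then show ?case
    \<comment> \<open>List positions start at 0, fibers at 1.\<close>
    by (intro bexI[of _ "Suc n"]) (auto simp: fiber_value_def)
qed

section \<open>Decomposition of integrals and probabilities over fibers\<close>

text \<open>Since \<open>t\<close> is injective on \<open>{1..m}\<close>, a point lies in no fiber
  but its own, and at most one summand survives.\<close>

lemma sum_indicator_fiber:
  fixes g :: "nat \<Rightarrow> 'b :: real_vector"
  assumes "\<omega> \<in> space \<Omega>" "Y \<omega> = t k" "k \<in> {1..m}" "J \<subseteq> {1..m}"
  shows "(\<Sum>j\<in>J. indicator (fiber \<Omega> X u j) \<omega> *\<^sub>R g j) = (if k \<in> J then g k else 0)"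
proof -
  have "finite J"
    using assms(4) finite_subset by blast
  have "(\<Sum>j\<in>J. indicator (fiber \<Omega> X u j) \<omega> *\<^sub>R g j) = (\<Sum>j\<in>J. if k = j then g j else 0)"
    using assms by (intro sum.cong) (auto simp: fiber_def fiber_value_eq_iff indicator_def)
  then show ?thesis
    using \<open>finite J\<close> by simp
qed

text \<open>The last assumption says that \<open>A\<close> is the union of the fibers in
  \<open>J\<close> up to points outside every fiber, and these are null by
  \<open>AE_in_fiber\<close>. It is applied to the whole space and to both sides of a cut.\<close>

lemma set_integral_fibers:
  fixes f :: "'w \<Rightarrow> 'b :: {banach, second_countable_topology}"
  assumes "integrable \<Omega> f" "A \<in> events" "J \<subseteq> {1..m}"
    and "\<And>\<omega> k. \<omega> \<in> space \<Omega> \<Longrightarrow> k \<in> {1..m} \<Longrightarrow> Y \<omega> = t k \<Longrightarrow> \<omega> \<in> A \<longleftrightarrow> k \<in> J"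
  shows "(LINT \<omega>:A|\<Omega>. f \<omega>) = (\<Sum>j\<in>J. LINT \<omega>:fiber \<Omega> X u j|\<Omega>. f \<omega>)"
proof -
  have int: "integrable \<Omega> (\<lambda>\<omega>. indicator (fiber \<Omega> X u j) \<omega> *\<^sub>R f \<omega>)" for j
    by (rule integrable_mult_indicator[OF measurable_fiber assms(1)])
  have "(LINT \<omega>:A|\<Omega>. f \<omega>) = (LINT \<omega>|\<Omega>. (\<Sum>j\<in>J. indicator (fiber \<Omega> X u j) \<omega> *\<^sub>R f \<omega>))"
    unfolding set_lebesgue_integral_def
  proof (rule integral_cong_AE)
    show "AE \<omega> in \<Omega>. indicator A \<omega> *\<^sub>R f \<omega>
        = (\<Sum>j\<in>J. indicator (fiber \<Omega> X u j) \<omega> *\<^sub>R f \<omega>)"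
      using AE_in_fiber AE_space
    proof eventually_elim
      case (elim \<omega>)
      then obtain k where k: "k \<in> {1..m}" "Y \<omega> = t k"
        by blast
      show ?case
        using sum_indicator_fiber[OF elim(2) k(2,1) assms(3), of "\<lambda>_. f \<omega>"] assms(4)[OF elim(2) k]
        by (simp add: indicator_def)
    qed
  qed (use assms(1,2) int in \<open>auto intro!: borel_measurable_integrable integrable_mult_indicator\<close>)
  also have "\<dots> = (\<Sum>j\<in>J. LINT \<omega>:fiber \<Omega> X u j|\<Omega>. f \<omega>)"
    unfolding set_lebesgue_integral_def using int by (intro Bochner_Integration.integral_sum)
  finally show ?thesis .
qed

lemma integral_fibers:
  fixes f :: "'w \<Rightarrow> 'b :: {banach, second_countable_topology}"
  assumes "integrable \<Omega> f"
  shows "(LINT \<omega>|\<Omega>. f \<omega>) = (\<Sum>j=1..m. LINT \<omega>:fiber \<Omega> X u j|\<Omega>. f \<omega>)"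
  using set_integral_fibers[OF assms, of "space \<Omega>" "{1..m}"] set_integral_space[OF assms]
  by simp

lemma prob_fibers:
  assumes "A \<in> events" "J \<subseteq> {1..m}"
    and "\<And>\<omega> k. \<omega> \<in> space \<Omega> \<Longrightarrow> k \<in> {1..m} \<Longrightarrow> Y \<omega> = t k \<Longrightarrow> \<omega> \<in> A \<longleftrightarrow> k \<in> J"
  shows "prob A = (\<Sum>j\<in>J. p j)"
proof -
  have "prob A = (LINT \<omega>:A|\<Omega>. 1)"
    using assms(1) by (simp add: set_lebesgue_integral_def)
  also have "\<dots> = (\<Sum>j\<in>J. LINT \<omega>:fiber \<Omega> X u j|\<Omega>. 1)"
    by (rule set_integral_fibers[OF _ assms]) simp
  also have "\<dots> = (\<Sum>j\<in>J. p j)"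
    by (simp add: set_lebesgue_integral_def fiber_prob_def)
  finally show ?thesis .
qed

lemma fiber_prob_pos: "j \<in> {1..m} \<Longrightarrow> p j > 0"
  using fiber_value_in_proj_values[of j] by (simp add: proj_values_def fiber_prob_def fiber_def)

lemma set_integral_fiber: "j \<in> {1..m} \<Longrightarrow> (LINT \<omega>:fiber \<Omega> X u j|\<Omega>. W \<omega>) = p j *\<^sub>R z j"
  using fiber_prob_pos[of j] by (simp add: barycenter_def cond_mean_def fiber_prob_def)

text \<open>Monotonicity of \<open>t\<close> turns the threshold on \<open>Y\<close> into one on the
  index, the form that \<open>set_integral_fibers\<close> asks for.\<close>

lemma in_left_event_iff:
  assumes "i \<in> {1..m}" "\<omega> \<in> space \<Omega>" "k \<in> {1..m}" "Y \<omega> = t k"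
  shows "\<omega> \<in> left_event \<Omega> X u i \<longleftrightarrow> k \<in> {1..i}"
  using assms fiber_value_le_iff[of k i] by (simp add: left_event_def)

lemma in_right_event_iff:
  assumes "i \<in> {1..m}" "\<omega> \<in> space \<Omega>" "k \<in> {1..m}" "Y \<omega> = t k"
  shows "\<omega> \<in> right_event \<Omega> X u i \<longleftrightarrow> k \<in> {i+1..m}"
  using assms fiber_value_le_iff[of k i] by (auto simp: right_event_def not_le[symmetric])

section \<open>Dispersion within and between fibers\<close>

lemma total_var_eq: "total_var \<Omega> X M = fib_var \<Omega> X M u + (\<Sum>j=1..m. p j * mat_sqnorm M (z j))"
proof -
  have int: "integrable \<Omega> (\<lambda>\<omega>. indicator (fiber \<Omega> X u j) \<omega> *\<^sub>R mat_sqnorm M (W \<omega> - z j))" for j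
    by (rule integrable_mult_indicator[OF measurable_fiber integrable_mat_sqnorm])
  have "fib_var \<Omega> X M u
      = (LINT \<omega>|\<Omega>. (\<Sum>j=1..m. indicator (fiber \<Omega> X u j) \<omega> *\<^sub>R mat_sqnorm M (W \<omega> - z j)))"
    unfolding fib_var_def
  proof (rule integral_cong_AE)
    \<comment> \<open>On fiber \<open>k\<close> both sums over the fibers reduce to their
      \<open>k\<close>th term, so \<open>barycenter_rv\<close> may be replaced by the constant
      \<open>z k\<close> there.\<close>
    show "AE \<omega> in \<Omega>. mat_sqnorm M (W \<omega> - barycenter_rv \<Omega> X u \<omega>)
        = (\<Sum>j=1..m. indicator (fiber \<Omega> X u j) \<omega> *\<^sub>R mat_sqnorm M (W \<omega> - z j))"
      using AE_in_fiber AE_space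
    proof eventually_elim
      case (elim \<omega>)
      then obtain k where k: "k \<in> {1..m}" "Y \<omega> = t k"
        by blast
      show ?case
        unfolding barycenter_rv_def sum_indicator_fiber[OF elim(2) k(2,1) order.refl]
        using k(1) by simp
    qed
    have "barycenter_rv \<Omega> X u \<in> borel_measurable \<Omega>"
      unfolding barycenter_rv_def by measurable
    moreover have "mat_sqnorm M \<in> borel_measurable borel"
      unfolding mat_sqnorm_def by (intro borel_measurable_continuous_onI continuous_intros)
    ultimately show "(\<lambda>\<omega>. mat_sqnorm M (W \<omega> - barycenter_rv \<Omega> X u \<omega>)) \<in> borel_measurable \<Omega>"
      by measurable
  qed (intro borel_measurable_integrable Bochner_Integration.integrable_sum int)
  also have "\<dots> = (\<Sum>j=1..m. LINT \<omega>:fiber \<Omega> X u j|\<Omega>. mat_sqnorm M (W \<omega> - z j))"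
    unfolding set_lebesgue_integral_def using int by (intro Bochner_Integration.integral_sum)
  \<comment> \<open>On fiber \<open>j\<close> the first moment is \<open>p j *\<^sub>R z j\<close>;
    with \<open>c = z j\<close> the cross term contributes -2 and the constant term +1 times
    \<open>p j * mat_sqnorm M (z j)\<close>.\<close>
  also have "\<dots> = (\<Sum>j=1..m. (LINT \<omega>:fiber \<Omega> X u j|\<Omega>. mat_sqnorm M (W \<omega>))
      - p j * mat_sqnorm M (z j))"
    by (intro sum.cong refl, subst set_integral_mat_sqnorm)
      (simp_all add: set_integral_fiber mat_inner_scaleR_right mat_sqnorm_def flip: fiber_prob_def)
  also have "\<dots> = total_var \<Omega> X M - (\<Sum>j=1..m. p j * mat_sqnorm M (z j))"
    using integral_fibers[OF integrable_mat_sqnorm[of 0]]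
    by (simp add: sum_subtractf total_var_def)
  finally show ?thesis
    by simp
qed

section \<open>Probabilities and moments of the two sides of a proper cut\<close>

context
  fixes i
  assumes i_pos: "1 \<le> i" and i_less: "i < m"
begin

lemma i_in: "i \<in> {1..m}"
  using i_pos i_less by simp

lemma left_prob_pos: "left_prob \<Omega> X u i > 0"
  unfolding left_prob_def using fiber_prob_pos i_pos i_less by (intro sum_pos) auto

text \<open>The fibers carry total mass 1, so the complement of the first \<open>i\<close> masses is
  the sum of the others.\<close>

lemma right_prob_eq: "right_prob \<Omega> X u i = (\<Sum>j=i+1..m. p j)"
  using prob_fibers[of "space \<Omega>" "{1..m}"] i_less
    sum.ub_add_nat[of 1 i p "m - i"]
  by (simp add: right_prob_def left_prob_def prob_space)

lemma right_prob_pos: "right_prob \<Omega> X u i > 0"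
  unfolding right_prob_eq using fiber_prob_pos i_pos i_less by (intro sum_pos) auto

lemma prob_left_event: "prob (left_event \<Omega> X u i) = left_prob \<Omega> X u i"
  unfolding left_prob_def
  using i_less by (intro prob_fibers in_left_event_iff[OF i_in]) auto

lemma prob_right_event: "prob (right_event \<Omega> X u i) = right_prob \<Omega> X u i"
  unfolding right_prob_eq
  by (intro prob_fibers in_right_event_iff[OF i_in]) auto

lemma left_moment_eq_sum: "left_moment \<Omega> X u i = (\<Sum>j=1..i. p j *\<^sub>R z j)"
proof -
  have "left_moment \<Omega> X u i = (\<Sum>j=1..i. LINT \<omega>:fiber \<Omega> X u j|\<Omega>. W \<omega>)"
    unfolding left_moment_def
    using i_less by (intro set_integral_fibers integrable_W in_left_event_iff[OF i_in]) auto
  also have "\<dots> = (\<Sum>j=1..i. p j *\<^sub>R z j)"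
    using i_less by (intro sum.cong set_integral_fiber) auto
  finally show ?thesis .
qed

lemma integral_split:
  fixes f :: "'w \<Rightarrow> 'b :: {banach, second_countable_topology}"
  assumes "integrable \<Omega> f"
  shows "(LINT \<omega>|\<Omega>. f \<omega>)
    = (LINT \<omega>:left_event \<Omega> X u i|\<Omega>. f \<omega>) + (LINT \<omega>:right_event \<Omega> X u i|\<Omega>. f \<omega>)"
proof -
  have "left_event \<Omega> X u i \<union> right_event \<Omega> X u i = space \<Omega>"
    by (auto simp: left_event_def right_event_def)
  moreover have "left_event \<Omega> X u i \<inter> right_event \<Omega> X u i = {}"
    by (auto simp: left_event_def right_event_def)
  moreover have "set_integrable \<Omega> A f" if "A \<in> events" for A
    unfolding set_integrable_def by (rule integrable_mult_indicator[OF that assms])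
  ultimately show ?thesis
    using set_integral_Un[of "left_event \<Omega> X u i" "right_event \<Omega> X u i" \<Omega> f]
      set_integral_space[OF assms] by simp
qed

text \<open>As \<open>W\<close> has mean zero, the moments of the two sides cancel; hence a single
  vector determines both means.\<close>

lemma right_moment_eq: "(LINT \<omega>:right_event \<Omega> X u i|\<Omega>. W \<omega>) = - left_moment \<Omega> X u i"
  using integral_split[OF integrable_W]
  by (simp add: expectation_W left_moment_def eq_neg_iff_add_eq_0 add.commute)

lemma right_sum_eq: "(\<Sum>j=i+1..m. p j *\<^sub>R z j) = - left_moment \<Omega> X u i"
proof -
  have "(LINT \<omega>:right_event \<Omega> X u i|\<Omega>. W \<omega>) = (\<Sum>j=i+1..m. LINT \<omega>:fiber \<Omega> X u j|\<Omega>. W \<omega>)"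
    by (intro set_integral_fibers integrable_W in_right_event_iff[OF i_in]) auto
  also have "\<dots> = (\<Sum>j=i+1..m. p j *\<^sub>R z j)"
    by (intro sum.cong set_integral_fiber) auto
  finally show ?thesis
    using right_moment_eq by simp
qed

lemma left_mean_eq: "left_mean \<Omega> X u i = (1 / left_prob \<Omega> X u i) *\<^sub>R left_moment \<Omega> X u i"
  by (simp add: left_mean_def left_moment_eq_sum)

lemma right_mean_eq: "right_mean \<Omega> X u i = - (1 / right_prob \<Omega> X u i) *\<^sub>R left_moment \<Omega> X u i"
  using right_sum_eq by (simp add: right_mean_def)

section \<open>The risk of a cut and its minimum\<close>

text \<open>Completing the square on each side separates the variables: \<alpha> and \<beta> each
  occur in one square only, weighted by the probability of their side.\<close>

lemma cut_risk_eq: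
  "cut_risk \<Omega> X M u i \<alpha> \<beta> = total_var \<Omega> X M
    - mat_sqnorm M (left_moment \<Omega> X u i) / left_prob \<Omega> X u i
    - mat_sqnorm M (left_moment \<Omega> X u i) / right_prob \<Omega> X u i
    + left_prob \<Omega> X u i * mat_sqnorm M (\<alpha> - expectation X - left_mean \<Omega> X u i)
    + right_prob \<Omega> X u i * mat_sqnorm M (\<beta> - expectation X - right_mean \<Omega> X u i)"
proof -
  let ?L = "left_event \<Omega> X u i" and ?R = "right_event \<Omega> X u i"
  have int: "integrable \<Omega> (\<lambda>\<omega>. indicator A \<omega> *\<^sub>R mat_sqnorm M (W \<omega> - c))" if "A \<in> events" for A c
    by (rule integrable_mult_indicator[OF that integrable_mat_sqnorm])
  \<comment> \<open>The moments are those of the centred vector, so the constants are translated by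
    the mean as well.\<close>
  have shift: "X \<omega> - c = W \<omega> - (c - expectation X)" for \<omega> c
    by (simp add: centred_def)
  have "cut_risk \<Omega> X M u i \<alpha> \<beta>
      = (LINT \<omega>:?L|\<Omega>. mat_sqnorm M (W \<omega> - (\<alpha> - expectation X)))
        + (LINT \<omega>:?R|\<Omega>. mat_sqnorm M (W \<omega> - (\<beta> - expectation X)))"
    using int[of ?L "\<alpha> - expectation X"] int[of ?R "\<beta> - expectation X"]
    by (simp add: cut_risk_def shift set_lebesgue_integral_def mult.commute)
  also have "(LINT \<omega>:?L|\<Omega>. mat_sqnorm M (W \<omega> - (\<alpha> - expectation X)))
      = (LINT \<omega>:?L|\<Omega>. mat_sqnorm M (W \<omega>)) - mat_sqnorm M (left_moment \<Omega> X u i) / left_prob \<Omega> X u i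
        + left_prob \<Omega> X u i * mat_sqnorm M (\<alpha> - expectation X - left_mean \<Omega> X u i)"
    using left_prob_pos
    by (simp add: set_integral_mat_sqnorm prob_left_event left_mean_eq
        mat_sqnorm_complete_square[OF symmetric_M] flip: left_moment_def)
  also have "(LINT \<omega>:?R|\<Omega>. mat_sqnorm M (W \<omega> - (\<beta> - expectation X)))
      = (LINT \<omega>:?R|\<Omega>. mat_sqnorm M (W \<omega>)) - mat_sqnorm M (left_moment \<Omega> X u i) / right_prob \<Omega> X u i
        + right_prob \<Omega> X u i * mat_sqnorm M (\<beta> - expectation X - right_mean \<Omega> X u i)"
    using right_prob_pos
    by (simp add: set_integral_mat_sqnorm prob_right_event right_mean_eq right_moment_eq
        mat_sqnorm_complete_square[OF symmetric_M] mat_sqnorm_minus)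
  \<comment> \<open>The second moments of the two sides add up to the total variance.\<close>
  finally show ?thesis
    using integral_split[OF integrable_mat_sqnorm[of 0]] by (simp add: total_var_def)
qed

lemma cut_value_eq:
  "cut_value \<Omega> X M u i = total_var \<Omega> X M
    - mat_sqnorm M (left_moment \<Omega> X u i) / left_prob \<Omega> X u i
    - mat_sqnorm M (left_moment \<Omega> X u i) / right_prob \<Omega> X u i" (is "_ = ?v")
proof -
  have "(LEAST v. \<exists>\<alpha> \<beta>. v = cut_risk \<Omega> X M u i \<alpha> \<beta>) = ?v"
  proof (rule Least_equality)
    \<comment> \<open>Both squares vanish at the side means. As these are means of the centred
      vector, the expectation is added back.\<close>
    have "?v = cut_risk \<Omega> X M u i (expectation X + left_mean \<Omega> X u i)
        (expectation X + right_mean \<Omega> X u i)"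
      by (simp add: cut_risk_eq) (simp add: mat_sqnorm_def mat_inner_def)
    then show "\<exists>\<alpha> \<beta>. ?v = cut_risk \<Omega> X M u i \<alpha> \<beta>"
      by blast
  next
    fix v
    assume "\<exists>\<alpha> \<beta>. v = cut_risk \<Omega> X M u i \<alpha> \<beta>"
    then show "?v \<le> v"
      using left_prob_pos right_prob_pos
      by (auto simp: cut_risk_eq mat_sqnorm_nonneg)
  qed
  then show ?thesis
    using i_pos i_less by (simp add: cut_value_def)
qed

section \<open>The gain of a cut and the fiberwise formula\<close>

lemma cut_gain_eq_moment:
  "cut_gain \<Omega> X M u i
    = mat_sqnorm M (left_moment \<Omega> X u i) / (left_prob \<Omega> X u i * right_prob \<Omega> X u i)"
proof -
  have "cut_gain \<Omega> X M u i = mat_sqnorm M (left_moment \<Omega> X u i)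
      * (1 / left_prob \<Omega> X u i + 1 / right_prob \<Omega> X u i)"
    by (simp add: cut_gain_def cut_value_eq algebra_simps)
  \<comment> \<open>The numerator of the sum over the common denominator is 1, because the two
    probabilities are complementary.\<close>
  also have "1 / left_prob \<Omega> X u i + 1 / right_prob \<Omega> X u i
      = 1 / (left_prob \<Omega> X u i * right_prob \<Omega> X u i)"
    using left_prob_pos right_prob_pos by (simp add: right_prob_def field_simps)
  finally show ?thesis
    by simp
qed

text \<open>The means are multiples of the same moment with opposite signs, so the reciprocals of
  the probabilities add in their difference. Squaring gives the factor
  \<open>1 / (P q)\<^sup>2\<close>, with \<open>P\<close> and \<open>q\<close> the two
  probabilities, and one factor \<open>P q\<close> cancels.\<close>

lemma cut_gain_eq_means:
  "cut_gain \<Omega> X M u i = left_prob \<Omega> X u i * right_prob \<Omega> X u i *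
    mat_sqnorm M (left_mean \<Omega> X u i - right_mean \<Omega> X u i)"
proof -
  have "left_mean \<Omega> X u i - right_mean \<Omega> X u i
      = (1 / left_prob \<Omega> X u i + 1 / right_prob \<Omega> X u i) *\<^sub>R left_moment \<Omega> X u i"
    by (simp add: left_mean_eq right_mean_eq algebra_simps)
  also have "1 / left_prob \<Omega> X u i + 1 / right_prob \<Omega> X u i
      = 1 / (left_prob \<Omega> X u i * right_prob \<Omega> X u i)"
    using left_prob_pos right_prob_pos by (simp add: right_prob_def field_simps)
  finally show ?thesis
    using left_prob_pos right_prob_pos
    by (simp add: cut_gain_eq_moment mat_sqnorm_scaleR power2_eq_square)
qed

text \<open>Centring the barycenters at the mean of each side subtracts exactly the two corrections
  in \<open>cut_value_eq\<close>; what remains is \<open>total_var_eq\<close> with its sum split at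
  \<open>i\<close>.\<close>

lemma cut_value_eq_fib_var:
  "cut_value \<Omega> X M u i = fib_var \<Omega> X M u
    + (\<Sum>j=1..i. p j * mat_sqnorm M (z j - left_mean \<Omega> X u i))
    + (\<Sum>j=i+1..m. p j * mat_sqnorm M (z j - right_mean \<Omega> X u i))"
proof -
  have "(\<Sum>j=1..i. p j * mat_sqnorm M (z j - left_mean \<Omega> X u i))
      = (\<Sum>j=1..i. p j * mat_sqnorm M (z j))
        - mat_sqnorm M (left_moment \<Omega> X u i) / left_prob \<Omega> X u i"
    using sum_mat_sqnorm_diff_mean[OF symmetric_M, of p "{1..i}" z] left_prob_pos
    unfolding left_prob_def[symmetric] left_mean_def left_moment_eq_sum by simp
  \<comment> \<open>The weighted barycenters on the right sum to minus the left moment; the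
    quadratic form ignores the sign.\<close>
  moreover have "(\<Sum>j=i+1..m. p j * mat_sqnorm M (z j - right_mean \<Omega> X u i))
      = (\<Sum>j=i+1..m. p j * mat_sqnorm M (z j))
        - mat_sqnorm M (left_moment \<Omega> X u i) / right_prob \<Omega> X u i"
    using sum_mat_sqnorm_diff_mean[OF symmetric_M, of p "{i+1..m}" z] right_prob_pos
    unfolding right_prob_eq[symmetric] right_mean_def right_sum_eq mat_sqnorm_minus by simp
  moreover have "(\<Sum>j=1..m. p j * mat_sqnorm M (z j))
      = (\<Sum>j=1..i. p j * mat_sqnorm M (z j)) + (\<Sum>j=i+1..m. p j * mat_sqnorm M (z j))"
    using sum.ub_add_nat[of 1 i "\<lambda>j. p j * mat_sqnorm M (z j)" "m - i"] i_less by simp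
  ultimately show ?thesis
    by (simp add: cut_value_eq total_var_eq)
qed

lemma left_moment_eq_left_mean:
  "left_moment \<Omega> X u i = left_prob \<Omega> X u i *\<^sub>R left_mean \<Omega> X u i"
  using left_prob_pos by (simp add: left_mean_eq)

lemma left_moment_eq_right_mean:
  "left_moment \<Omega> X u i = - (right_prob \<Omega> X u i *\<^sub>R right_mean \<Omega> X u i)"
  using right_prob_pos by (simp add: right_mean_eq)

end

end

theorem theorem6p1:
  fixes \<Omega> :: "'w measure" and X :: "'w \<Rightarrow> real^'d" and M :: "real^'d^'d" and u :: "real^'d"
  assumes "prob_space \<Omega>"
    and "X \<in> borel_measurable \<Omega>"
    and "\<exists>F. finite F \<and> (AE \<omega> in \<Omega>. X \<omega> \<in> F)"
    and "transpose M = M"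
    and "\<forall>x. x \<noteq> 0 \<longrightarrow> x \<bullet> (M *v x) > 0"
    and "u \<noteq> 0"
  shows
    "(\<forall>i. 1 \<le> i \<and> i < num_fibers \<Omega> X u \<longrightarrow>
        cut_value \<Omega> X M u i =
          fib_var \<Omega> X M u
          + (\<Sum>j = 1..i. fiber_prob \<Omega> X u j *
               mat_sqnorm M (barycenter \<Omega> X u j - left_mean \<Omega> X u i))
          + (\<Sum>j = i+1..num_fibers \<Omega> X u. fiber_prob \<Omega> X u j *
               mat_sqnorm M (barycenter \<Omega> X u j - right_mean \<Omega> X u i)))
     \<and> cut_value \<Omega> X M u 0 = total_var \<Omega> X M
     \<and> cut_value \<Omega> X M u (num_fibers \<Omega> X u) = total_var \<Omega> X M
     \<and> total_var \<Omega> X M =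
          fib_var \<Omega> X M u
          + (\<Sum>j = 1..num_fibers \<Omega> X u. fiber_prob \<Omega> X u j * mat_sqnorm M (barycenter \<Omega> X u j))
     \<and> (\<forall>i. 1 \<le> i \<and> i < num_fibers \<Omega> X u \<longrightarrow>
          left_moment \<Omega> X u i = left_prob \<Omega> X u i *\<^sub>R left_mean \<Omega> X u i
        \<and> left_moment \<Omega> X u i = - (right_prob \<Omega> X u i *\<^sub>R right_mean \<Omega> X u i)
        \<and> cut_value \<Omega> X M u i = total_var \<Omega> X M - cut_gain \<Omega> X M u i
        \<and> cut_gain \<Omega> X M u i = left_prob \<Omega> X u i * right_prob \<Omega> X u i *
            mat_sqnorm M (left_mean \<Omega> X u i - right_mean \<Omega> X u i)
        \<and> cut_gain \<Omega> X M u i =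
            mat_sqnorm M (left_moment \<Omega> X u i) / (left_prob \<Omega> X u i * right_prob \<Omega> X u i))
     \<and> cut_gain \<Omega> X M u 0 = 0
     \<and> cut_gain \<Omega> X M u (num_fibers \<Omega> X u) = 0"
proof -
  \<comment> \<open>Any finite set carrying almost all values of \<open>X\<close> can serve as the
    locale parameter.\<close>
  obtain F where "finite F" "AE \<omega> in \<Omega>. X \<omega> \<in> F"
    using assms(3) by blast
  then interpret finite_random_vector \<Omega> X M u F
    using assms by (intro finite_random_vector.intro finite_random_vector_axioms.intro) auto
  have "cut_value \<Omega> X M u 0 = total_var \<Omega> X M" "cut_value \<Omega> X M u m = total_var \<Omega> X M"
    by (simp_all add: cut_value_def)
  moreover from this have "cut_gain \<Omega> X M u 0 = 0" "cut_gain \<Omega> X M u m = 0"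
    by (simp_all add: cut_gain_def)
  \<comment> \<open>This holds at every index, since the gain is defined as the difference.\<close>
  moreover have "cut_value \<Omega> X M u i = total_var \<Omega> X M - cut_gain \<Omega> X M u i" for i
    by (simp add: cut_gain_def)
  ultimately show ?thesis
    using cut_value_eq_fib_var total_var_eq left_moment_eq_left_mean left_moment_eq_right_mean
      cut_gain_eq_means cut_gain_eq_moment
    by blast
qed

end
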